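(* For every $d\in\overline D$, $P_{\mathrm{DL}}(d)$ is the set of all $x\in P_{\mathrm{AP}}$ satisfying $$\sum_{ij\in C}(x_{ij}+x_{ji})-\sum_{ij\in C}(d_{ij}+d_{ji})x_{ji}\leq |C|-\sum_{ij\in C}d_{ij}\quad\text{for all } C\in\mathcal C_1 \text{ with } |C|\geq 3,$$ $$x_{ij}+x_{ji}\leq 1\quad\text{for all } ij\in A_1.$$
   Context: Let $n\ge 4$, $N=\{1,\dots,n\}$, $A=\{ij : i,j\in N,\ i\ne j\}$, $N_1=N\setminus\{1\}$, $A_1=\{ij : i,j\in N_1,\ i\neq j\}$. $\mathcal C_1$ is the set of (simple) directed cycles with arcs in $A_1$, each of length at least 2 and identified with its set of arcs; $|C|$ is the number of arcs. $P_{\mathrm{AP}}$ is the set of $x\in[0,1]^A$ with $\sum_{j\neq i}x_{ij}=1$ and $\sum_{j\ne i}x_{ji}=1$ for all $i\in N$. $\overline D=\{d\in\mathbb R_+^{A_1} : \sum_{ij\in C}d_{ij}\le 1\ \text{for all } C\in\mathcal C_1\}$, where $\mathbb R_+$ denotes the nonnegative reals. For $d\in\overline D$, $$Q_{\mathrm{DL}}(d)=\{(x,u)\in P_{\mathrm{AP}}\times\mathbb R^{N_1} : u_i-u_j+x_{ij}+(1-d_{ij}-d_{ji})x_{ji}\le 1-d_{ij}\ \text{for all } ij\in A_1\},$$ and $P_{\mathrm{DL}}(d)=\{x : \exists u\in\mathbb R^{N_1},\ (x,u)\in Q_{\mathrm{DL}}(d)\}$ is its projection onto the $x$ variables. *)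

theory Defs
  imports Complex_Main "HOL-Library.FuncSet" "Graph_Theory.Arc_Walk"
begin

text \<open>
  The arc \<open>ij\<close> is the pair \<open>(i, j)\<close>, and a vector indexed by a finite set \<open>I\<close> is a function
  that is \<^const>\<open>undefined\<close> outside \<open>I\<close>, so that \<open>\<real>\<^sup>I\<close> is the extensional
  function space \<^term>\<open>I \<rightarrow>\<^sub>E (UNIV :: real set)\<close>.
\<close>

definition nodes :: "nat \<Rightarrow> nat set" where
  "nodes n = {1..n}"

definition node_arcs :: "nat \<Rightarrow> (nat \<times> nat) set" where
  "node_arcs n = {(i, j). i \<in> nodes n \<and> j \<in> nodes n \<and> i \<noteq> j}"

definition nodes1 :: "nat \<Rightarrow> nat set" where
  "nodes1 n = nodes n - {1}"

definition arcs1 :: "nat \<Rightarrow> (nat \<times> nat) set" where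
  "arcs1 n = {(i, j). i \<in> nodes1 n \<and> j \<in> nodes1 n \<and> i \<noteq> j}"

definition digraph1 :: "nat \<Rightarrow> (nat, nat \<times> nat) pre_digraph" where
  "digraph1 n = \<lparr>verts = nodes1 n, arcs = arcs1 n, tail = fst, head = snd\<rparr>"

text \<open>
  \<^const>\<open>pre_digraph.cycle\<close> describes a simple directed cycle as the list of its arcs, with a
  chosen starting point; here a cycle is the set of its arcs. There are no loops, so every cycle
  has at least two arcs, and \<open>|C|\<close> is \<^term>\<open>card C\<close>.
\<close>

definition cycles1 :: "nat \<Rightarrow> (nat \<times> nat) set set" where
  "cycles1 n = {set p | p. pre_digraph.cycle (digraph1 n) p}"

definition P_AP :: "nat \<Rightarrow> (nat \<times> nat \<Rightarrow> real) set" where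
  "P_AP n = {x \<in> node_arcs n \<rightarrow>\<^sub>E {0..1}.
     \<forall>i\<in>nodes n. (\<Sum>j\<in>nodes n - {i}. x (i, j)) = 1 \<and> (\<Sum>j\<in>nodes n - {i}. x (j, i)) = 1}"

definition D_bar :: "nat \<Rightarrow> (nat \<times> nat \<Rightarrow> real) set" where
  "D_bar n = {d \<in> arcs1 n \<rightarrow>\<^sub>E {0..}. \<forall>C\<in>cycles1 n. (\<Sum>(i, j)\<in>C. d (i, j)) \<le> 1}"

definition Q_DL :: "nat \<Rightarrow> (nat \<times> nat \<Rightarrow> real) \<Rightarrow> ((nat \<times> nat \<Rightarrow> real) \<times> (nat \<Rightarrow> real)) set" where
  "Q_DL n d = {(x, u) \<in> P_AP n \<times> (nodes1 n \<rightarrow>\<^sub>E UNIV). \<forall>(i, j)\<in>arcs1 n.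
     u i - u j + x (i, j) + (1 - d (i, j) - d (j, i)) * x (j, i) \<le> 1 - d (i, j)}"

definition P_DL :: "nat \<Rightarrow> (nat \<times> nat \<Rightarrow> real) \<Rightarrow> (nat \<times> nat \<Rightarrow> real) set" where
  "P_DL n d = {x. \<exists>u \<in> nodes1 n \<rightarrow>\<^sub>E UNIV. (x, u) \<in> Q_DL n d}"

lemma loopfree_digraph_digraph1: "loopfree_digraph (digraph1 n)"
  by unfold_locales (auto simp: digraph1_def arcs1_def)

lemma cycle_digraph1_card:
  assumes "pre_digraph.cycle (digraph1 n) p"
  shows "card (set p) = length p" "2 \<le> length p"
proof -
  interpret loopfree_digraph "digraph1 n" by (rule loopfree_digraph_digraph1)
  show "card (set p) = length p"
    using assms by (auto simp: cycle_conv distinct_card)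
  show "2 \<le> length p"
    using assms by (auto simp: cycle_digraph_conv)
qed

end

theory Submission
  imports Defs
begin

text \<open>
  For fixed \<open>x\<close> the constraints of \<^const>\<open>Q_DL\<close> read \<open>u\<^sub>i - u\<^sub>j \<le> c\<^sub>i\<^sub>j\<close> with
  \<open>c\<^sub>i\<^sub>j = 1 - d\<^sub>i\<^sub>j - x\<^sub>i\<^sub>j - (1 - d\<^sub>i\<^sub>j - d\<^sub>j\<^sub>i) x\<^sub>j\<^sub>i\<close>: they ask for a potential \<open>u\<close> of the
  complete digraph on \<open>N\<^sub>1\<close> with arc costs \<open>c\<close>. Such a potential exists iff no simple cycle has
  negative cost (\<open>feasible_potential_iff\<close>), so projecting out \<open>u\<close> leaves one inequality
  \<open>c(C) \<ge> 0\<close> per cycle \<open>C\<close>.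

  Rearranged, \<open>c(C) \<ge> 0\<close> is the inequality that the theorem states for \<open>|C| \<ge> 3\<close>. For a cycle
  \<open>C = {ij, ji}\<close> the cost factors as \<open>(2 - d\<^sub>i\<^sub>j - d\<^sub>j\<^sub>i) (1 - x\<^sub>i\<^sub>j - x\<^sub>j\<^sub>i)\<close>. Membership of \<open>d\<close> in
  \<^const>\<open>D_bar\<close> gives \<open>d\<^sub>i\<^sub>j + d\<^sub>j\<^sub>i \<le> 1\<close>, so the first factor is positive and the inequality
  reduces to \<open>x\<^sub>i\<^sub>j + x\<^sub>j\<^sub>i \<le> 1\<close>.
\<close>

lemma (in wf_digraph) sum_list_potential_difference:
  fixes u :: "'a \<Rightarrow> 'c::ab_group_add"
  assumes "awalk v p w"
  shows "(\<Sum>a\<leftarrow>p. u (tail G a) - u (head G a)) = u v - u w"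
  using assms by (induction p arbitrary: v) (auto simp: awalk_simps)

text \<open>
  If the path \<open>p\<close> avoids the tail of \<open>a\<close>, take \<open>p' = a # p\<close>. Otherwise cut \<open>p\<close> at that
  tail: the first part closes up with \<open>a\<close> to a cycle, and dropping this cycle from \<open>a # p\<close> does not
  increase the cost.
\<close>

lemma (in wf_digraph) prepend_arc_to_apath:
  fixes c :: "'b \<Rightarrow> 'c::ordered_ab_group_add"
  assumes nonneg: "\<And>q. cycle q \<Longrightarrow> 0 \<le> (\<Sum>a\<leftarrow>q. c a)"
    and a: "a \<in> arcs G" and p: "apath (head G a) p w"
  obtains p' where "apath (tail G a) p' w" "(\<Sum>e\<leftarrow>p'. c e) \<le> c a + (\<Sum>e\<leftarrow>p. c e)"
proof (cases "tail G a \<in> set (awalk_verts (head G a) p)")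
  case False
  then have "apath (tail G a) (a # p) w"
    using a p by (simp add: apath_Cons_iff)
  then show thesis by (rule that) simp
next
  case True
  then obtain xs ys where "awalk_verts (head G a) p = xs @ tail G a # ys"
    by (meson split_list)
  moreover have "cas (head G a) p w"
    using p by (auto simp: apath_def)
  ultimately obtain q r where q: "cas (head G a) q (tail G a)" and pqr: "p = q @ r"
    using awalk_decomp_verts by metis
  then have last_q: "awlast (head G a) q = tail G a"
    by (simp add: awlast_if_cas)
  have path_q: "apath (head G a) q (tail G a)" and path_r: "apath (tail G a) r w"
    using p unfolding pqr by (simp_all add: apath_append_iff last_q)
  have "awalk (tail G a) (a # q) (tail G a)"
    using path_q a by (simp add: apath_def awalk_Cons_iff)
  moreover have "distinct (tl (awalk_verts (tail G a) (a # q)))"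
    using path_q by (simp add: apath_def)
  ultimately have "cycle (a # q)"
    unfolding cycle_def by blast
  then have "0 \<le> c a + (\<Sum>e\<leftarrow>q. c e)"
    using nonneg by fastforce
  then have "(\<Sum>e\<leftarrow>r. c e) \<le> c a + (\<Sum>e\<leftarrow>p. c e)"
    unfolding pqr by (simp add: add.assoc[symmetric])
  with path_r show thesis by (rule that)
qed

text \<open>
  A potential telescopes along every closed walk, so cycles cost at least \<open>0\<close>. Conversely, the
  cheapest cost of a simple path that starts at \<open>v\<close>, with any end, is a potential: there are finitely many
  such paths, the empty one among them, and an arc put in front of a cheapest path can be
  absorbed by \<open>prepend_arc_to_apath\<close>. The end is left free because a fixed target may be
  unreachable from \<open>v\<close>.
\<close>

theorem (in fin_digraph) feasible_potential_iff:
  fixes c :: "'b \<Rightarrow> 'c::linordered_ab_group_add"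
  shows "(\<exists>u. \<forall>a\<in>arcs G. u (tail G a) - u (head G a) \<le> c a) \<longleftrightarrow>
    (\<forall>p. cycle p \<longrightarrow> 0 \<le> (\<Sum>a\<leftarrow>p. c a))"
proof (intro iffI allI impI)
  fix p
  assume "\<exists>u. \<forall>a\<in>arcs G. u (tail G a) - u (head G a) \<le> c a" and "cycle p"
  then obtain u v where u: "\<forall>a\<in>arcs G. u (tail G a) - u (head G a) \<le> c a" and p: "awalk v p v"
    unfolding cycle_def by blast
  have "0 = (\<Sum>a\<leftarrow>p. u (tail G a) - u (head G a))"
    using sum_list_potential_difference[OF p, of u] by simp
  also have "\<dots> \<le> (\<Sum>a\<leftarrow>p. c a)"
    using u p by (intro sum_list_mono) auto
  finally show "0 \<le> (\<Sum>a\<leftarrow>p. c a)" .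
next
  assume nonneg: "\<forall>p. cycle p \<longrightarrow> 0 \<le> (\<Sum>a\<leftarrow>p. c a)"
  define S where "S v = (\<lambda>p. \<Sum>a\<leftarrow>p. c a) ` {p. \<exists>w. apath v p w}" for v
  have finite_S: "finite (S v)" for v
  proof -
    have "{p. \<exists>w. apath v p w} \<subseteq> (\<lambda>(u, p, w). p) ` {(u, p, w). apath u p w}"
      by force
    then show ?thesis
      unfolding S_def using apaths_finite_triple by (meson finite_imageI finite_subset)
  qed
  have "Min (S (tail G a)) - Min (S (head G a)) \<le> c a" if a: "a \<in> arcs G" for a
  proof -
    have "apath (head G a) [] (head G a)"
      using a by (simp add: apath_Nil_iff)
    then have "S (head G a) \<noteq> {}"
      unfolding S_def by blast
    with finite_S have "Min (S (head G a)) \<in> S (head G a)"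
      by (rule Min_in)
    then obtain p w where p: "apath (head G a) p w" "Min (S (head G a)) = (\<Sum>e\<leftarrow>p. c e)"
      unfolding S_def by blast
    from nonneg a p(1) obtain p' where p': "apath (tail G a) p' w"
      "(\<Sum>e\<leftarrow>p'. c e) \<le> c a + (\<Sum>e\<leftarrow>p. c e)"
      using prepend_arc_to_apath by metis
    have "Min (S (tail G a)) \<le> (\<Sum>e\<leftarrow>p'. c e)"
      using finite_S p'(1) by (intro Min_le) (auto simp: S_def)
    with p'(2) show ?thesis
      by (simp add: p(2) diff_le_eq)
  qed
  then show "\<exists>u. \<forall>a\<in>arcs G. u (tail G a) - u (head G a) \<le> c a"
    by (intro exI[of _ "\<lambda>v. Min (S v)"]) blast
qed

lemma fin_digraph_digraph1: "fin_digraph (digraph1 n)"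
proof -
  interpret loopfree_digraph "digraph1 n" by (rule loopfree_digraph_digraph1)
  have "arcs1 n \<subseteq> nodes1 n \<times> nodes1 n"
    by (auto simp: arcs1_def)
  moreover have "finite (nodes1 n)"
    by (simp add: nodes1_def nodes_def)
  ultimately show ?thesis
    by unfold_locales (auto simp: digraph1_def intro: finite_subset)
qed

lemma cycles1_potential_iff:
  fixes c :: "nat \<times> nat \<Rightarrow> real"
  shows "(\<exists>u\<in>nodes1 n \<rightarrow>\<^sub>E UNIV. \<forall>(i, j)\<in>arcs1 n. u i - u j \<le> c (i, j)) \<longleftrightarrow>
    (\<forall>C\<in>cycles1 n. 0 \<le> sum c C)"
proof -
  interpret fin_digraph "digraph1 n" by (rule fin_digraph_digraph1)
  have "(\<exists>u\<in>nodes1 n \<rightarrow>\<^sub>E UNIV. \<forall>(i, j)\<in>arcs1 n. u i - u j \<le> c (i, j)) \<longleftrightarrow>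
      (\<exists>u. \<forall>(i, j)\<in>arcs1 n. u i - u j \<le> c (i, j))"
  proof (intro iffI; elim exE bexE)
    fix u :: "nat \<Rightarrow> real"
    assume "\<forall>(i, j)\<in>arcs1 n. u i - u j \<le> c (i, j)"
    then show "\<exists>u\<in>nodes1 n \<rightarrow>\<^sub>E UNIV. \<forall>(i, j)\<in>arcs1 n. u i - u j \<le> c (i, j)"
      by (intro bexI[of _ "restrict u (nodes1 n)"]) (auto simp: arcs1_def)
  qed blast
  also have "\<dots> \<longleftrightarrow> (\<forall>p. cycle p \<longrightarrow> 0 \<le> (\<Sum>a\<leftarrow>p. c a))"
    using feasible_potential_iff[of c] by (simp add: digraph1_def split_beta)
  also have "\<dots> \<longleftrightarrow> (\<forall>C\<in>cycles1 n. 0 \<le> sum c C)"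
  proof -
    have "(\<Sum>a\<leftarrow>p. c a) = sum c (set p)" if "cycle p" for p
      using that by (auto simp: cycle_conv sum_list_distinct_conv_sum_set)
    then show ?thesis
      unfolding cycles1_def by auto
  qed
  finally show ?thesis .
qed

lemma two_cycle_in_cycles1:
  assumes "(i, j) \<in> arcs1 n"
  shows "{(i, j), (j, i)} \<in> cycles1 n"
proof -
  interpret fin_digraph "digraph1 n" by (rule fin_digraph_digraph1)
  have "cycle [(i, j), (j, i)]"
    unfolding cycle_def using assms
    by (intro exI[of _ i]) (simp add: awalk_simps, auto simp: digraph1_def arcs1_def)
  then show ?thesis
    unfolding cycles1_def by (intro CollectI exI[of _ "[(i, j), (j, i)]"]) simp
qed

lemma cycles1_cases:
  assumes "C \<in> cycles1 n"
  obtains "3 \<le> card C" | i j where "(i, j) \<in> arcs1 n" "C = {(i, j), (j, i)}"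
proof -
  interpret fin_digraph "digraph1 n" by (rule fin_digraph_digraph1)
  obtain p where p: "cycle p" "C = set p"
    using assms unfolding cycles1_def by blast
  show thesis
  proof (cases "3 \<le> card C")
    case True
    then show thesis by (rule that(1))
  next
    case False
    with p cycle_digraph1_card[OF p(1)] have "length p = 2" by simp
    then obtain a b where ab: "p = [a, b]"
      by (auto simp: length_Suc_conv numeral_2_eq_2)
    have "a \<in> arcs (digraph1 n)" "tail (digraph1 n) b = head (digraph1 n) a"
      "head (digraph1 n) b = tail (digraph1 n) a"
      using p(1) unfolding ab by (auto simp: cycle_def awalk_simps)
    then have "a \<in> arcs1 n" "b = (snd a, fst a)"
      by (simp_all add: digraph1_def prod_eq_iff)
    then show thesis
      using p(2) ab by (intro that(2)[of "fst a" "snd a"]) auto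
  qed
qed

theorem proposition20:
  fixes n :: nat and d :: "nat \<times> nat \<Rightarrow> real"
  assumes "n \<ge> 4" and "d \<in> D_bar n"
  shows "P_DL n d = {x \<in> P_AP n.
    (\<forall>C\<in>cycles1 n. card C \<ge> 3 \<longrightarrow>
      (\<Sum>(i, j)\<in>C. x (i, j) + x (j, i)) - (\<Sum>(i, j)\<in>C. (d (i, j) + d (j, i)) * x (j, i))
        \<le> real (card C) - (\<Sum>(i, j)\<in>C. d (i, j))) \<and>
    (\<forall>(i, j)\<in>arcs1 n. x (i, j) + x (j, i) \<le> 1)}"
proof -
  define c :: "(nat \<times> nat \<Rightarrow> real) \<Rightarrow> nat \<times> nat \<Rightarrow> real" where
    "c x = (\<lambda>(i, j). 1 - d (i, j) - x (i, j) - (1 - d (i, j) - d (j, i)) * x (j, i))" for x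
  have projection: "x \<in> P_DL n d \<longleftrightarrow> x \<in> P_AP n \<and> (\<forall>C\<in>cycles1 n. 0 \<le> sum (c x) C)" for x
  proof -
    have "x \<in> P_DL n d \<longleftrightarrow> x \<in> P_AP n \<and>
        (\<exists>u\<in>nodes1 n \<rightarrow>\<^sub>E UNIV. \<forall>(i, j)\<in>arcs1 n. u i - u j \<le> c x (i, j))"
      unfolding P_DL_def Q_DL_def c_def by (force simp: algebra_simps)
    then show ?thesis
      by (simp only: cycles1_potential_iff)
  qed
  have cost: "sum (c x) C = (real (card C) - (\<Sum>(i, j)\<in>C. d (i, j))) -
      ((\<Sum>(i, j)\<in>C. x (i, j) + x (j, i)) - (\<Sum>(i, j)\<in>C. (d (i, j) + d (j, i)) * x (j, i)))"
    for x C
  proof -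
    have "sum (c x) C = (\<Sum>(i, j)\<in>C. (1 - d (i, j)) -
        ((x (i, j) + x (j, i)) - (d (i, j) + d (j, i)) * x (j, i)))"
      by (intro sum.cong) (auto simp: c_def algebra_simps)
    then show ?thesis
      by (simp add: split_beta sum_subtractf)
  qed
  have two_cycle: "0 \<le> sum (c x) {(i, j), (j, i)} \<longleftrightarrow> x (i, j) + x (j, i) \<le> 1"
    if ij: "(i, j) \<in> arcs1 n" for x i j
  proof -
    have ne: "i \<noteq> j"
      using ij by (simp add: arcs1_def)
    have "(\<Sum>(i, j)\<in>{(i, j), (j, i)}. d (i, j)) \<le> 1"
      using assms(2) two_cycle_in_cycles1[OF ij] unfolding D_bar_def by blast
    then have pos: "0 < 2 - d (i, j) - d (j, i)"
      using ne by simp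
    have "sum (c x) {(i, j), (j, i)} = (2 - d (i, j) - d (j, i)) * (1 - x (i, j) - x (j, i))"
      using ne by (simp add: c_def algebra_simps)
    then show ?thesis
      using pos by (simp only: zero_le_mult_iff) linarith
  qed
  have "(\<forall>C\<in>cycles1 n. 0 \<le> sum (c x) C) \<longleftrightarrow>
      (\<forall>C\<in>cycles1 n. 3 \<le> card C \<longrightarrow> 0 \<le> sum (c x) C) \<and>
      (\<forall>(i, j)\<in>arcs1 n. x (i, j) + x (j, i) \<le> 1)" for x
  proof (intro iffI ballI)
    assume "\<forall>C\<in>cycles1 n. 0 \<le> sum (c x) C"
    then show "(\<forall>C\<in>cycles1 n. 3 \<le> card C \<longrightarrow> 0 \<le> sum (c x) C) \<and>
        (\<forall>(i, j)\<in>arcs1 n. x (i, j) + x (j, i) \<le> 1)"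
      using two_cycle two_cycle_in_cycles1 by blast
  next
    fix C
    assume C: "C \<in> cycles1 n" and
      *: "(\<forall>C\<in>cycles1 n. 3 \<le> card C \<longrightarrow> 0 \<le> sum (c x) C) \<and>
        (\<forall>(i, j)\<in>arcs1 n. x (i, j) + x (j, i) \<le> 1)"
    from C show "0 \<le> sum (c x) C"
    proof (cases rule: cycles1_cases)
      case 1
      then show ?thesis using * C by blast
    next
      case (2 i j)
      then show ?thesis using * two_cycle by blast
    qed
  qed
  with projection show ?thesis
    by (auto simp: cost)
qed

end
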